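(* Let $G$ be a group and let $X,Y$ be normal subsets of $G$. Set $M=\langle X\rangle$, $N=\langle Y\rangle$, $Z:=M\cap N$, and assume that $G=M\circ_Z N$. For each $m\in M$ and $n\in N$ let $M_m$ and $N_n$ be, respectively, the stabilizers in $Z$ of the conjugacy classes $m^G$ and $n^G$ with respect to the multiplication action of $Z$. Set $\mathcal{M}=\{M_m\}_{m\in M}$ and $\mathcal{N}=\{N_n\}_{n\in N}$. For every $m\in M$ and every $n\in N$ set $X_m:=(m^{-1}X)\cap Z$ and $Y_n:=(n^{-1}Y)\cap Z$. Then $G=X\times Y$ if and only if the pair of multisets $(\{X_m\}_{m\in M},\{Y_n\}_{n\in N})$ is an $\mathcal{M}\mathcal{N}$-direct factorization system of $Z$.
   Context: Groups may be infinite. A subset of a group $G$ is normal if it is invariant under conjugation by all elements of $G$. Set-direct product: for a group $G$ and non-empty subsets $X,Y\subseteq G$, the setwise product $XY$ is called direct, and is then written $X\times Y$, if both $X$ and $Y$ are normal in $G$ and every $g\in XY$ has a unique representation $g=xy$ with $x\in X$, $y\in Y$. Central product: $G=M\circ_Z N$ means that $M,N$ are subgroups of $G$ with $G=MN$, $M$ and $N$ centralize each other, and $Z=M\cap N$ (then $M,N$ are normal and $Z$ is central in $G$). Multiplication action: if $K\trianglelefteq G$ and $Z\le K$ is a central subgroup of $G$, then $Z$ acts by multiplication, $(z,C)\mapsto zC$, on the set $\Omega_K$ of all conjugacy classes of $G$ contained in $K$. Kernel: for an abelian group $H$ and $S\subseteq H$, $K_H(S):=\{h\in H: hS=S\}$,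 a subgroup of $H$. Direct factorization system: let $Z$ be an abelian group and let $\mathcal{M}=\{M_i\}_{i\in I}$ and $\mathcal{N}=\{N_j\}_{j\in J}$ be two multisets (indexed families, repetitions allowed) of subgroups of $Z$. An $\mathcal{M}\mathcal{N}$-direct factorization system of $Z$ is a pair of multisets $\{A_i\}_{i\in I}$, $\{B_j\}_{j\in J}$ of subsets of $Z$ such that for all $i\in I$, $j\in J$: $Z=A_i\times B_j$, $M_i\le K_Z(A_i)$, and $N_j\le K_Z(B_j)$. *)

theory Defs
  imports "HOL-Algebra.Group_Action" "HOL-Algebra.Generated_Groups"
begin

definition normal_subset :: "('a, 'b) monoid_scheme \<Rightarrow> 'a set \<Rightarrow> bool" where
  "normal_subset G X \<longleftrightarrow>
     X \<subseteq> carrier G \<and> (\<forall>g\<in>carrier G. g <#\<^bsub>G\<^esub> X #>\<^bsub>G\<^esub> inv\<^bsub>G\<^esub> g = X)"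

definition set_direct :: "('a, 'b) monoid_scheme \<Rightarrow> 'a set \<Rightarrow> 'a set \<Rightarrow> bool" where
  "set_direct G X Y \<longleftrightarrow>
     X \<noteq> {} \<and> Y \<noteq> {} \<and> normal_subset G X \<and> normal_subset G Y \<and>
     (\<forall>g\<in>X <#>\<^bsub>G\<^esub> Y. \<exists>!p. p \<in> X \<times> Y \<and> g = fst p \<otimes>\<^bsub>G\<^esub> snd p)"

text \<open>\<open>G = X \<times> Y\<close>: the setwise product is direct and is all of \<open>G\<close>.\<close>

definition is_set_direct_product ::
    "('a, 'b) monoid_scheme \<Rightarrow> 'a set \<Rightarrow> 'a set \<Rightarrow> bool" where
  "is_set_direct_product G X Y \<longleftrightarrow> set_direct G X Y \<and> carrier G = X <#>\<^bsub>G\<^esub> Y"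

definition central_product ::
    "('a, 'b) monoid_scheme \<Rightarrow> 'a set \<Rightarrow> 'a set \<Rightarrow> 'a set \<Rightarrow> bool" where
  "central_product G M N Z \<longleftrightarrow>
     subgroup M G \<and> subgroup N G \<and> carrier G = M <#>\<^bsub>G\<^esub> N \<and>
     (\<forall>m\<in>M. \<forall>n\<in>N. m \<otimes>\<^bsub>G\<^esub> n = n \<otimes>\<^bsub>G\<^esub> m) \<and> Z = M \<inter> N"

text \<open>The conjugacy class as an orbit of the conjugation action, in the form
  used by \<open>group.action_by_conjugation\<close>.\<close>

definition conj_class :: "('a, 'b) monoid_scheme \<Rightarrow> 'a \<Rightarrow> 'a set" where
  "conj_class G x =
     orbit G (\<lambda>g. \<lambda>h\<in>carrier G. g \<otimes>\<^bsub>G\<^esub> h \<otimes>\<^bsub>G\<^esub> inv\<^bsub>G\<^esub> g) x"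

definition conj_classes_in :: "('a, 'b) monoid_scheme \<Rightarrow> 'a set \<Rightarrow> 'a set set" where
  "conj_classes_in G K = {C. C \<subseteq> K \<and> (\<exists>x\<in>carrier G. C = conj_class G x)}"

text \<open>For a central subgroup \<open>Z \<subseteq> K\<close> this is an action of \<open>G\<lparr>carrier := Z\<rparr>\<close> on
  \<open>conj_classes_in G K\<close>; the restriction follows the convention of
  \<^locale>\<open>group_action\<close>.\<close>

definition mult_action :: "('a, 'b) monoid_scheme \<Rightarrow> 'a set \<Rightarrow> 'a \<Rightarrow> 'a set \<Rightarrow> 'a set" where
  "mult_action G K = (\<lambda>z. \<lambda>C\<in>conj_classes_in G K. z <#\<^bsub>G\<^esub> C)"

definition mult_kernel :: "('a, 'b) monoid_scheme \<Rightarrow> 'a set \<Rightarrow> 'a set" where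
  "mult_kernel H S = {h \<in> carrier H. h <#\<^bsub>H\<^esub> S = S}"

text \<open>Multisets are families: \<open>MM\<close> and \<open>A\<close> are indexed by \<open>I\<close>, \<open>NN\<close> and \<open>B\<close> by \<open>J\<close>,
  and values outside the index sets are irrelevant.  The requirements that \<open>H\<close> be abelian
  and that \<open>MM\<close> and \<open>NN\<close> consist of subgroups are built in.\<close>

definition direct_factorization_system ::
    "('a, 'b) monoid_scheme \<Rightarrow> 'i set \<Rightarrow> 'j set \<Rightarrow> ('i \<Rightarrow> 'a set) \<Rightarrow> ('j \<Rightarrow> 'a set) \<Rightarrow>
     ('i \<Rightarrow> 'a set) \<Rightarrow> ('j \<Rightarrow> 'a set) \<Rightarrow> bool" where
  "direct_factorization_system H I J MM NN A B \<longleftrightarrow>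
     comm_group H \<and>
     (\<forall>i\<in>I. subgroup (MM i) H \<and> A i \<subseteq> carrier H) \<and>
     (\<forall>j\<in>J. subgroup (NN j) H \<and> B j \<subseteq> carrier H) \<and>
     (\<forall>i\<in>I. \<forall>j\<in>J. is_set_direct_product H (A i) (B j) \<and>
        MM i \<subseteq> mult_kernel H (A i) \<and> NN j \<subseteq> mult_kernel H (B j))"

end

theory Submission
  imports Defs
begin

text \<open>
  Elements of \<open>Z\<close> are central. For \<open>m \<in> M\<close>, \<open>n \<in> N\<close>, \<open>z \<in> Z\<close>, a factorization
  \<open>m n z = x y\<close> with \<open>x \<in> X\<close>, \<open>y \<in> Y\<close> gives \<open>m\<^sup>-\<^sup>1 x = n z y\<^sup>-\<^sup>1 \<in> M \<inter> N = Z\<close>, so \<open>x = m a\<close>,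
  \<open>y = n b\<close> with \<open>a \<in> X\<^sub>m\<close>, \<open>b \<in> Y\<^sub>n\<close> and \<open>z = a b\<close>. Hence factorizations in \<open>X Y\<close> of elements
  of the coset \<open>m n Z\<close> correspond to factorizations in \<open>X\<^sub>m Y\<^sub>n\<close> of elements of \<open>Z\<close>. The
  conditions on the kernels hold always: if \<open>z m = g m g\<^sup>-\<^sup>1\<close> and \<open>m a \<in> X\<close>, then
  \<open>m z a = g (m a) g\<^sup>-\<^sup>1 \<in> X\<close>.
\<close>

section \<open>Unique factorizations and normal subsets\<close>

lemma ex1_pairE:
  assumes "\<exists>!p. p \<in> A \<times> B \<and> P (fst p) (snd p)"
  obtains a b where "a \<in> A" "b \<in> B" "P a b"
    "\<forall>a'\<in>A. \<forall>b'\<in>B. P a' b' \<longrightarrow> a' = a \<and> b' = b"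
proof -
  obtain p where p: "p \<in> A \<times> B \<and> P (fst p) (snd p)"
    and uniq: "\<forall>q. q \<in> A \<times> B \<and> P (fst q) (snd q) \<longrightarrow> q = p"
    using assms by (rule ex1E)
  have "a' = fst p \<and> b' = snd p" if "a' \<in> A" "b' \<in> B" "P a' b'" for a' b'
    using uniq[rule_format, of "(a', b')"] that by auto
  with p that[of "fst p" "snd p"] show thesis
    by (simp add: mem_Times_iff)
qed

lemma normal_subset_conj:
  fixes G (structure)
  assumes "normal_subset G X" "x \<in> X" "g \<in> carrier G"
  shows "g \<otimes> x \<otimes> inv g \<in> X"
proof -
  have "g \<otimes> x \<otimes> inv g \<in> g <# X #> inv g"
    using assms(2) by (auto simp: l_coset_def r_coset_def)
  then show ?thesis
    using assms by (auto simp: normal_subset_def)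
qed

text \<open>Conjugation is trivial in an abelian group, so the normality built into direct products
  inside \<open>Z\<close> reduces to containment.\<close>

lemma (in comm_group) normal_subset_iff: "normal_subset G A \<longleftrightarrow> A \<subseteq> carrier G"
proof
  assume A: "A \<subseteq> carrier G"
  have "g <# A #> inv g = A" if g: "g \<in> carrier G" for g
  proof -
    have "g \<otimes> a \<otimes> inv g = a" if "a \<in> A" for a
      using that A g by (metis inv_closed inv_solve_right m_closed m_comm subsetD)
    then show ?thesis
      by (auto simp: l_coset_def r_coset_def)
  qed
  with A show "normal_subset G A"
    by (simp add: normal_subset_def)
qed (simp add: normal_subset_def)

text \<open>For normal sets, covering the group and uniqueness merge into one condition on all
  elements; nonemptiness comes from factorizing \<open>\<one>\<close>.\<close>

lemma is_set_direct_product_iff: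
  fixes G (structure)
  assumes "group G" "normal_subset G X" "normal_subset G Y"
  shows "is_set_direct_product G X Y \<longleftrightarrow>
    (\<forall>g\<in>carrier G. \<exists>!p. p \<in> X \<times> Y \<and> g = fst p \<otimes> snd p)"
proof -
  interpret group G by fact
  have sub: "X \<subseteq> carrier G" "Y \<subseteq> carrier G"
    using assms by (auto simp: normal_subset_def)
  show ?thesis
  proof
    assume "is_set_direct_product G X Y"
    then show "\<forall>g\<in>carrier G. \<exists>!p. p \<in> X \<times> Y \<and> g = fst p \<otimes> snd p"
      by (simp add: is_set_direct_product_def set_direct_def)
  next
    assume R: "\<forall>g\<in>carrier G. \<exists>!p. p \<in> X \<times> Y \<and> g = fst p \<otimes> snd p"
    have fac: "\<exists>x\<in>X. \<exists>y\<in>Y. g = x \<otimes> y" if "g \<in> carrier G" for g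
      using bspec[OF R that, THEN ex1_implies_ex] by auto
    then have "carrier G = X <#> Y"
      using sub by (auto simp: set_mult_def)
    moreover have "X \<noteq> {}" "Y \<noteq> {}"
      using fac[OF one_closed] by auto
    ultimately show "is_set_direct_product G X Y"
      using R assms by (simp add: is_set_direct_product_def set_direct_def)
  qed
qed

section \<open>Conjugacy classes and their stabilizers under multiplication\<close>

context group
begin

lemma conj_class_eq:
  assumes "x \<in> carrier G"
  shows "conj_class G x = (\<lambda>g. g \<otimes> x \<otimes> inv g) ` carrier G"
  using assms by (auto simp: conj_class_def orbit_def)

lemma generate_normal_subset:
  assumes "normal_subset G X"
  shows "generate G X \<lhd> G"
  using assms normal_subset_conj[OF assms]
  by (intro normal_generateI) (auto simp: normal_subset_def)

lemma conj_class_in_normal: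
  assumes "K \<lhd> G" "x \<in> K"
  shows "conj_class G x \<in> conj_classes_in G K"
proof -
  interpret K: normal K G by fact
  have "x \<in> carrier G"
    using assms by (simp add: K.mem_carrier)
  with assms show ?thesis
    by (auto simp: conj_classes_in_def conj_class_eq K.inv_op_closed2)
qed

text \<open>Makes the stabilizers admissible members of a factorization system; its closure under
  inverses also serves the kernel conditions.\<close>

lemma subgroup_setwise_translation_stabilizer:
  assumes "subgroup H G" "C \<subseteq> carrier G"
  shows "subgroup {z \<in> H. z <# C = C} (G\<lparr>carrier := H\<rparr>)"
proof -
  interpret H: subgroup H G by fact
  show ?thesis
  proof (rule group.subgroupI)
    show "group (G\<lparr>carrier := H\<rparr>)"
      by (rule H.subgroup_is_group) unfold_locales
    show "{z \<in> H. z <# C = C} \<noteq> {}"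
      using lcos_mult_one[OF assms(2)] H.one_closed by blast
  next
    fix z assume z: "z \<in> {z \<in> H. z <# C = C}"
    then have "inv z <# C = C"
      using lcos_m_assoc[OF assms(2), of "inv z" z] lcos_mult_one[OF assms(2)] by simp
    with z show "inv\<^bsub>G\<lparr>carrier := H\<rparr>\<^esub> z \<in> {z \<in> H. z <# C = C}"
      using assms(1) by (simp add: m_inv_consistent)
  next
    fix y z assume yz: "y \<in> {z \<in> H. z <# C = C}" "z \<in> {z \<in> H. z <# C = C}"
    then have "(y \<otimes> z) <# C = C"
      using lcos_m_assoc[OF assms(2), of y z] by simp
    with yz show "y \<otimes>\<^bsub>G\<lparr>carrier := H\<rparr>\<^esub> z \<in> {z \<in> H. z <# C = C}"
      by simp
  qed simp
qed

text \<open>The class of \<open>x\<close> lies in the normal subgroup \<open>K\<close>, so the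
  restricted function \<open>mult_action\<close> really multiplies there and does not return
  \<open>undefined\<close>.\<close>

lemma stabilizer_mult_action:
  assumes "K \<lhd> G" "x \<in> K"
  shows "stabilizer (G\<lparr>carrier := Z\<rparr>) (mult_action G K) (conj_class G x) =
    {z \<in> Z. z <# conj_class G x = conj_class G x}"
  using conj_class_in_normal[OF assms] by (auto simp: stabilizer_def mult_action_def)

lemma subgroup_stabilizer_mult_action:
  assumes "K \<lhd> G" "x \<in> K" "subgroup Z G"
  shows "subgroup (stabilizer (G\<lparr>carrier := Z\<rparr>) (mult_action G K) (conj_class G x))
    (G\<lparr>carrier := Z\<rparr>)"
proof -
  have "conj_class G x \<subseteq> carrier G"
    using conj_class_in_normal[OF assms(1,2)] assms(1)
    by (auto simp: conj_classes_in_def dest: normal_imp_subgroup subgroup.mem_carrier)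
  then show ?thesis
    using assms by (simp add: stabilizer_mult_action subgroup_setwise_translation_stabilizer)
qed

lemma mem_inv_translate_Int_iff:
  assumes "x \<in> carrier G" "X \<subseteq> carrier G" "Z \<subseteq> carrier G"
  shows "a \<in> (inv x <# X) \<inter> Z \<longleftrightarrow> a \<in> Z \<and> x \<otimes> a \<in> X"
proof -
  have "a \<in> inv x <# X" if "a \<in> Z" "x \<otimes> a \<in> X"
  proof -
    have "a = inv x \<otimes> (x \<otimes> a)"
      using that assms by (auto simp: m_assoc[symmetric])
    with that show ?thesis
      by (auto simp: l_coset_def)
  qed
  then show ?thesis
    using assms by (auto simp: l_coset_def m_assoc[symmetric] subset_iff)
qed

text \<open>Supplies the kernel conditions of the system, independently of any factorization of
  \<open>G\<close>. Translation by a stabilizing element maps the set into itself; the same fact for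
  its inverse gives equality.\<close>

lemma stabilizer_mult_action_subset_mult_kernel:
  assumes "K \<lhd> G" "x \<in> K" "subgroup Z G" "normal_subset G X"
    and central: "\<And>z g. z \<in> Z \<Longrightarrow> g \<in> carrier G \<Longrightarrow> z \<otimes> g = g \<otimes> z"
  shows "stabilizer (G\<lparr>carrier := Z\<rparr>) (mult_action G K) (conj_class G x)
    \<subseteq> mult_kernel (G\<lparr>carrier := Z\<rparr>) ((inv x <# X) \<inter> Z)" (is "?S \<subseteq> mult_kernel ?H ?A")
proof
  interpret Z: subgroup Z G by fact
  have x: "x \<in> carrier G"
    using assms(1,2) by (auto dest: normal_imp_subgroup subgroup.mem_carrier)
  have X: "X \<subseteq> carrier G"
    using assms(4) by (simp add: normal_subset_def)
  note A_iff = mem_inv_translate_Int_iff[OF x X Z.subset]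
  have S: "subgroup ?S ?H"
    by (rule subgroup_stabilizer_mult_action) fact+
  have translate: "s \<otimes> a \<in> ?A" if s: "s \<in> ?S" and a: "a \<in> ?A" for s a
  proof -
    have sZ: "s \<in> Z" and sC: "s <# conj_class G x = conj_class G x"
      using s assms(1,2) by (auto simp: stabilizer_mult_action)
    have aZ: "a \<in> Z" and xa: "x \<otimes> a \<in> X"
      using a A_iff by auto
    \<comment> \<open>The equality of classes is evaluated at the representative \<open>x\<close>,
      conjugated by \<open>\<one>\<close>, to obtain the conjugating element
      \<open>g\<close>.\<close>
    have "x \<in> conj_class G x"
      using x by (auto simp: conj_class_eq image_iff intro!: bexI[of _ \<one>])
    then have "s \<otimes> x \<in> conj_class G x"
      using sC by (auto simp: l_coset_def)
    then obtain g where g: "g \<in> carrier G" "s \<otimes> x = g \<otimes> x \<otimes> inv g"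
      using x by (auto simp: conj_class_eq)
    have "x \<otimes> (s \<otimes> a) = s \<otimes> x \<otimes> a"
      using x sZ aZ central[of s x] by (simp add: m_assoc[symmetric])
    also have "\<dots> = g \<otimes> x \<otimes> (inv g \<otimes> a)"
      using g x aZ by (simp add: m_assoc)
    \<comment> \<open>The central \<open>a\<close> passes \<open>inv g\<close>, so the conjugate of
      \<open>x\<close> becomes a conjugate of an element of \<open>X\<close>.\<close>
    also have "\<dots> = g \<otimes> (x \<otimes> a) \<otimes> inv g"
      using g x aZ central[of a "inv g"] by (simp add: m_assoc)
    finally have "x \<otimes> (s \<otimes> a) \<in> X"
      using normal_subset_conj[OF assms(4) xa g(1)] by simp
    then show ?thesis
      using A_iff[of "s \<otimes> a"] sZ aZ by blast
  qed
  fix s assume s: "s \<in> ?S"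
  then have sZ: "s \<in> Z"
    using assms(1,2) by (auto simp: stabilizer_mult_action)
  have inv_s: "inv s \<in> ?S"
    using subgroup.m_inv_closed[OF S s] sZ \<open>subgroup Z G\<close> by (simp add: m_inv_consistent)
  have "?A \<subseteq> s <# ?A"
  proof
    fix a assume a: "a \<in> ?A"
    then have "a = s \<otimes> (inv s \<otimes> a)"
      using sZ by (auto simp: m_assoc[symmetric])
    then show "a \<in> s <# ?A"
      using translate[OF inv_s a] by (auto simp: l_coset_def)
  qed
  moreover have "s <# ?A \<subseteq> ?A"
    using translate[OF s] by (auto simp: l_coset_def)
  ultimately have "s <# ?A = ?A"
    by blast
  moreover have "s <#\<^bsub>?H\<^esub> ?A = s <# ?A"
    by (simp add: l_coset_def)
  ultimately show "s \<in> mult_kernel ?H ?A"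
    using sZ by (simp add: mult_kernel_def)
qed

end

section \<open>Factorizations in \<open>G\<close> and factorizations in \<open>Z\<close>\<close>

theorem theorem1p5:
  fixes G :: "('a, 'b) monoid_scheme" (structure)
    and X Y M N Z :: "'a set"
    and MM NN XX YY :: "'a \<Rightarrow> 'a set"
  assumes "group G"
    and "normal_subset G X" and "normal_subset G Y"
    and "M = generate G X" and "N = generate G Y" and "Z = M \<inter> N"
    and "central_product G M N Z"
    and "\<And>m. m \<in> M \<Longrightarrow> MM m = stabilizer (G\<lparr>carrier := Z\<rparr>) (mult_action G M) (conj_class G m)"
    and "\<And>n. n \<in> N \<Longrightarrow> NN n = stabilizer (G\<lparr>carrier := Z\<rparr>) (mult_action G N) (conj_class G n)"
    and "\<And>m. m \<in> M \<Longrightarrow> XX m = (inv m <# X) \<inter> Z"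
    and "\<And>n. n \<in> N \<Longrightarrow> YY n = (inv n <# Y) \<inter> Z"
  shows "is_set_direct_product G X Y \<longleftrightarrow>
    direct_factorization_system (G\<lparr>carrier := Z\<rparr>) M N MM NN XX YY"
proof -
  interpret group G by fact
  have X: "X \<subseteq> carrier G" and Y: "Y \<subseteq> carrier G"
    using assms(2,3) by (auto simp: normal_subset_def)
  have Mn: "M \<lhd> G" and Nn: "N \<lhd> G"
    using assms(2-5) by (auto intro: generate_normal_subset)
  have XM: "X \<subseteq> M" and YN: "Y \<subseteq> N"
    unfolding assms(4,5) by (auto intro: generate.incl)
  have MN: "carrier G = M <#> N" and comm: "\<And>m n. m \<in> M \<Longrightarrow> n \<in> N \<Longrightarrow> m \<otimes> n = n \<otimes> m"
    using assms(7) by (auto simp: central_product_def)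
  interpret M: subgroup M G by (rule normal_imp_subgroup) fact
  interpret N: subgroup N G by (rule normal_imp_subgroup) fact
  have Zsub: "subgroup Z G"
    unfolding assms(6) by (rule subgroups_Inter_pair) unfold_locales
  interpret Z: subgroup Z G by fact
  have ZM: "z \<in> M" and ZN: "z \<in> N" if "z \<in> Z" for z
    using that assms(6) by auto
  \<comment> \<open>With \<open>g = m \<otimes> n\<close>, the element \<open>z\<close> commutes
    with \<open>m\<close> because it lies in \<open>N\<close>, and with \<open>n\<close> because it
    lies in \<open>M\<close>.\<close>
  have central: "z \<otimes> g = g \<otimes> z" if z: "z \<in> Z" and g: "g \<in> carrier G" for z g
  proof -
    obtain m n where mn: "m \<in> M" "n \<in> N" "g = m \<otimes> n"
      using g MN by (auto simp: set_mult_def)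
    then show ?thesis
      using z comm[of z n] comm[of m z] ZM ZN by (metis M.mem_carrier N.mem_carrier m_assoc)
  qed
  let ?H = "G\<lparr>carrier := Z\<rparr>"
  have H: "comm_group ?H"
    using central Z.subgroup_is_group[OF \<open>group G\<close>]
    by (intro group.group_comm_groupI) auto
  have XX_iff: "a \<in> XX m \<longleftrightarrow> a \<in> Z \<and> m \<otimes> a \<in> X" if "m \<in> M" for m a
    \<comment> \<open>Deleting \<open>Int_iff\<close> keeps the intersection whole, so that the
      membership lemma can match it.\<close>
    using that X by (simp add: assms(10) mem_inv_translate_Int_iff[OF _ _ Z.subset] del: Int_iff)
  have YY_iff: "b \<in> YY n \<longleftrightarrow> b \<in> Z \<and> n \<otimes> b \<in> Y" if "n \<in> N" for n b
    using that Y by (simp add: assms(11) mem_inv_translate_Int_iff[OF _ _ Z.subset] del: Int_iff)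
  have MM: "subgroup (MM m) ?H" "MM m \<subseteq> mult_kernel ?H (XX m)" "XX m \<subseteq> Z" if "m \<in> M" for m
    using subgroup_stabilizer_mult_action[OF Mn that Zsub] that
      stabilizer_mult_action_subset_mult_kernel[OF Mn that Zsub assms(2) central]
    by (simp_all add: assms(8,10))
  have NN: "subgroup (NN n) ?H" "NN n \<subseteq> mult_kernel ?H (YY n)" "YY n \<subseteq> Z" if "n \<in> N" for n
    using subgroup_stabilizer_mult_action[OF Nn that Zsub] that
      stabilizer_mult_action_subset_mult_kernel[OF Nn that Zsub assms(3) central]
    by (simp_all add: assms(9,11))
  have "is_set_direct_product ?H (XX m) (YY n) \<longleftrightarrow>
      (\<forall>z\<in>Z. \<exists>!p. p \<in> XX m \<times> YY n \<and> z = fst p \<otimes> snd p)" if "m \<in> M" "n \<in> N" for m n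
    using is_set_direct_product_iff[of ?H "XX m" "YY n"] MM(3) NN(3) that
      comm_group.axioms(2)[OF H] comm_group.normal_subset_iff[OF H]
    by simp
  \<comment> \<open>The subgroup and kernel conditions always hold and drop out; only unique
    factorization in \<open>Z\<close> remains to be compared with that in \<open>G\<close>.\<close>
  then have "direct_factorization_system ?H M N MM NN XX YY \<longleftrightarrow>
      (\<forall>m\<in>M. \<forall>n\<in>N. \<forall>z\<in>Z. \<exists>!p. p \<in> XX m \<times> YY n \<and> z = fst p \<otimes> snd p)"
    using H MM NN by (simp add: direct_factorization_system_def)
  also have "\<dots> \<longleftrightarrow> (\<forall>g\<in>carrier G. \<exists>!p. p \<in> X \<times> Y \<and> g = fst p \<otimes> snd p)"
  proof -
    have mult4: "m \<otimes> a \<otimes> (n \<otimes> b) = m \<otimes> n \<otimes> (a \<otimes> b)"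
      if "m \<in> M" "n \<in> N" "a \<in> Z" "b \<in> Z" for m n a b
    proof -
      have "m \<otimes> a \<otimes> (n \<otimes> b) = m \<otimes> (a \<otimes> n) \<otimes> b"
        using that by (simp add: m_assoc)
      also have "a \<otimes> n = n \<otimes> a"
        using that central[of a n] by simp
      also have "m \<otimes> (n \<otimes> a) \<otimes> b = m \<otimes> n \<otimes> (a \<otimes> b)"
        using that by (simp add: m_assoc)
      finally show ?thesis .
    qed
    have split: "\<exists>a\<in>XX m. \<exists>b\<in>YY n. x = m \<otimes> a \<and> y = n \<otimes> b \<and> z = a \<otimes> b"
      if m: "m \<in> M" and n: "n \<in> N" and z: "z \<in> Z" and x: "x \<in> X" and y: "y \<in> Y"
        and eq: "m \<otimes> n \<otimes> z = x \<otimes> y" for m n z x y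
    proof -
      define a where "a = inv m \<otimes> x"
      define b where "b = inv n \<otimes> y"
      have c[simp]: "m \<in> carrier G" "n \<in> carrier G" "z \<in> carrier G" "x \<in> carrier G" "y \<in> carrier G"
        using m n z x y X Y by auto
      have xa: "x = m \<otimes> a" and yb: "y = n \<otimes> b"
        by (simp_all add: a_def b_def m_assoc[symmetric])
      have aM: "a \<in> M" and bN: "b \<in> N"
        using m n x y XM YN by (auto simp: a_def b_def)
      have "m \<otimes> (n \<otimes> z) = m \<otimes> (a \<otimes> y)"
        using eq aM by (simp add: xa m_assoc)
      then have nz: "n \<otimes> z = a \<otimes> y"
        using aM by simp
      \<comment> \<open>All three factors on the right lie in \<open>N\<close>, which puts
        \<open>a\<close>, already in \<open>M\<close>, into \<open>Z\<close>.\<close>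
      then have "a = n \<otimes> z \<otimes> inv y"
        using aM by (simp add: m_assoc)
      then have "a \<in> N"
        using n z y YN ZN by auto
      then have aZ: "a \<in> Z"
        using aM assms(6) by simp
      \<comment> \<open>Now that \<open>a\<close> is central, \<open>n\<close> cancels; then
        \<open>b = inv a \<otimes> z\<close> lies in \<open>Z\<close> as well.\<close>
      have "n \<otimes> z = n \<otimes> (a \<otimes> b)"
        using nz aZ bN central[of a n] by (simp add: yb m_assoc[symmetric])
      then have zab: "z = a \<otimes> b"
        using aZ bN by simp
      then have "b = inv a \<otimes> z"
        using aZ bN by (simp add: m_assoc[symmetric])
      then have "b \<in> Z"
        using aZ z by simp
      then show ?thesis
        using aZ x y xa yb zab XX_iff[OF m] YY_iff[OF n] by blast
    qed
    show ?thesis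
    proof (intro iffI ballI)
      fix g assume "g \<in> carrier G"
        and Z: "\<forall>m\<in>M. \<forall>n\<in>N. \<forall>z\<in>Z. \<exists>!p. p \<in> XX m \<times> YY n \<and> z = fst p \<otimes> snd p"
      \<comment> \<open>The trailing \<open>\<one>\<close> writes \<open>g\<close> in the form
        \<open>m \<otimes> n \<otimes> z\<close> that \<open>split\<close> expects, so
        factorizations of \<open>g\<close> are matched with those of \<open>\<one>\<close> in
        \<open>Z\<close>.\<close>
      then obtain m n where mn: "m \<in> M" "n \<in> N" "g = m \<otimes> n \<otimes> \<one>"
        using MN by (auto simp: set_mult_def)
      have "\<exists>!p. p \<in> XX m \<times> YY n \<and> \<one> = fst p \<otimes> snd p"
        using Z mn(1,2) Z.one_closed by blast
      then obtain a b where ab: "a \<in> XX m" "b \<in> YY n" "\<one> = a \<otimes> b"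
        and uniq: "\<forall>a'\<in>XX m. \<forall>b'\<in>YY n. \<one> = a' \<otimes> b' \<longrightarrow> a' = a \<and> b' = b"
        by (rule ex1_pairE[of "XX m" "YY n" "\<lambda>a b. \<one> = a \<otimes> b"]) (rule that)
      show "\<exists>!p. p \<in> X \<times> Y \<and> g = fst p \<otimes> snd p"
      proof (rule ex1I[of _ "(m \<otimes> a, n \<otimes> b)"])
        have "m \<otimes> a \<in> X" "n \<otimes> b \<in> Y" "a \<in> Z" "b \<in> Z"
          using ab XX_iff YY_iff mn by auto
        then show "(m \<otimes> a, n \<otimes> b) \<in> X \<times> Y \<and> g = fst (m \<otimes> a, n \<otimes> b) \<otimes> snd (m \<otimes> a, n \<otimes> b)"
          using mult4[of m n a b] mn ab(3) by simp
      next
        fix p assume "p \<in> X \<times> Y \<and> g = fst p \<otimes> snd p"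
        then have "fst p \<in> X" "snd p \<in> Y" "m \<otimes> n \<otimes> \<one> = fst p \<otimes> snd p"
          using mn(3) by auto
        \<comment> \<open>Any competing pair is \<open>m\<close>, \<open>n\<close> times a
          factorization of \<open>\<one>\<close>, and that one is unique.\<close>
        from split[OF mn(1,2) Z.one_closed this] show "p = (m \<otimes> a, n \<otimes> b)"
          using uniq by (auto simp: prod_eq_iff)
      qed
    next
      fix m n z assume mnz: "m \<in> M" "n \<in> N" "z \<in> Z"
        and G: "\<forall>g\<in>carrier G. \<exists>!p. p \<in> X \<times> Y \<and> g = fst p \<otimes> snd p"
      then have "\<exists>!p. p \<in> X \<times> Y \<and> m \<otimes> n \<otimes> z = fst p \<otimes> snd p"
        by simp
      then obtain x y where xy: "x \<in> X" "y \<in> Y" "m \<otimes> n \<otimes> z = x \<otimes> y"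
        and uniq: "\<forall>x'\<in>X. \<forall>y'\<in>Y. m \<otimes> n \<otimes> z = x' \<otimes> y' \<longrightarrow> x' = x \<and> y' = y"
        by (rule ex1_pairE[of X Y "\<lambda>x y. m \<otimes> n \<otimes> z = x \<otimes> y"]) (rule that)
      obtain a b where ab: "a \<in> XX m" "b \<in> YY n" "x = m \<otimes> a" "y = n \<otimes> b" "z = a \<otimes> b"
        using split[OF mnz xy] by blast
      show "\<exists>!p. p \<in> XX m \<times> YY n \<and> z = fst p \<otimes> snd p"
      proof (rule ex1I[of _ "(a, b)"])
        show "(a, b) \<in> XX m \<times> YY n \<and> z = fst (a, b) \<otimes> snd (a, b)"
          using ab by simp
      next
        fix p assume p: "p \<in> XX m \<times> YY n \<and> z = fst p \<otimes> snd p"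
        then have q: "fst p \<in> Z" "m \<otimes> fst p \<in> X" "snd p \<in> Z" "n \<otimes> snd p \<in> Y"
          using XX_iff[OF mnz(1)] YY_iff[OF mnz(2)] by (auto simp: mem_Times_iff)
        \<comment> \<open>By \<open>mult4\<close>, multiplying the components of \<open>p\<close> by
          \<open>m\<close> and \<open>n\<close> factorizes \<open>m \<otimes> n \<otimes> z\<close>
          in \<open>G\<close>; uniqueness there, followed by cancellation, determines
          \<open>p\<close>.\<close>
        then have "m \<otimes> fst p = m \<otimes> a \<and> n \<otimes> snd p = n \<otimes> b"
          using uniq[rule_format, of "m \<otimes> fst p" "n \<otimes> snd p"] mult4[of m n "fst p" "snd p"]
            mnz p ab by simp
        moreover have "a \<in> Z" "b \<in> Z"
          using ab XX_iff[OF mnz(1)] YY_iff[OF mnz(2)] by auto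
        ultimately show "p = (a, b)"
          using q mnz by (simp add: prod_eq_iff)
      qed
    qed
  qed
  also have "\<dots> \<longleftrightarrow> is_set_direct_product G X Y"
    using is_set_direct_product_iff[OF assms(1-3)] by simp
  finally show ?thesis ..
qed

end
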